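(* Let $f:\mathcal{D}\subseteq\mathbb{R}^n\to\mathbb{R}^m$ be continuously differentiable, let $g(x)=\frac12\|f(x)\|_2^2$, let $x_k\in\mathcal{D}$, let $\xi_k\subseteq\{1,\dots,n\}$ be a set of selected column indices, and let $\delta\in(0,2)$. Put $p_k=I_{:,\xi_k}\nabla f_{:,\xi_k}(x_k)^Tf(x_k)$ and $$\eta_k=\delta\,\frac{(\nabla f(x_k)p_k)^Tf(x_k)}{(\nabla f(x_k)p_k)^T\nabla f(x_k)p_k},\qquad d_k=-\eta_k I_{:,\xi_k}\nabla f_{:,\xi_k}(x_k)^Tf(x_k).$$ If $\|\nabla f_{:,\xi_k}(x_k)^Tf(x_k)\|_2^2\neq0$, then $d_k$ is a strict descent direction of $g$ at $x_k$, i.e. $d_k^T\nabla g(x_k)<0$.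
   Context: $\nabla f(x)\in\mathbb{R}^{m\times n}$ is the Jacobian matrix of $f$ at $x$; for an index set $\xi\subseteq\{1,\dots,n\}$, $\nabla f_{:,\xi}(x)$ is the submatrix of $\nabla f(x)$ formed by the columns with indices in $\xi$, and $I_{:,\xi}$ is the submatrix of the $n\times n$ identity matrix formed by the columns with indices in $\xi$. $\|\cdot\|_2$ is the Euclidean norm. $\nabla g(x)=\nabla f(x)^Tf(x)$ is the gradient of $g$. *)

theory Defs
  imports "HOL-Analysis.Analysis"
begin

text \<open>
  Since \<open>\<xi>\<close> is a set of column indices that varies inside the logic, the columns of the submatrix
  \<open>A\<^bsub>:,\<xi>\<^esub>\<close> cannot be indexed by a type. The submatrix is the family of the columns
  of \<open>A\<close> with index set \<open>\<xi>\<close>, undefined at every other index (no padding by zero columns), and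
  a vector of length \<open>|\<xi>|\<close> is a family of reals with index set \<open>\<xi>\<close>. The Euclidean norm
  of such a vector \<open>v\<close> is \<open>L2_set v \<xi>\<close>.
\<close>

definition col_submatrix :: "real^'n^'m \<Rightarrow> 'n set \<Rightarrow> 'n \<Rightarrow> real^'m"
  where "col_submatrix A \<xi> = (\<lambda>j\<in>\<xi>. column j A)"

text \<open>\<open>B v\<close> and \<open>B\<^sup>T y\<close> for a matrix \<open>B\<close> whose columns are indexed by \<open>\<xi>\<close>:\<close>

definition submatrix_mult :: "'n set \<Rightarrow> ('n \<Rightarrow> real^'m) \<Rightarrow> ('n \<Rightarrow> real) \<Rightarrow> real^'m"
  where "submatrix_mult \<xi> B v = (\<Sum>j\<in>\<xi>. v j *\<^sub>R B j)"

definition submatrix_transpose_mult :: "'n set \<Rightarrow> ('n \<Rightarrow> real^'m) \<Rightarrow> real^'m \<Rightarrow> 'n \<Rightarrow> real"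
  where "submatrix_transpose_mult \<xi> B y = (\<lambda>j\<in>\<xi>. B j \<bullet> y)"

text \<open>
  For every enumeration \<open>s\<close> of \<open>\<xi>\<close> by a type, these operations agree with the library's
  operations on the matrix whose columns are those of \<open>A\<close> listed by \<open>s\<close>.
\<close>

lemma submatrix_mult_enum:
  fixes A :: "real^'n^'m" and s :: "'s::finite \<Rightarrow> 'n"
  assumes "bij_betw s UNIV \<xi>"
  shows "submatrix_mult \<xi> (col_submatrix A \<xi>) v = (\<chi> i j. A $ i $ s j) *v (\<chi> j. v (s j))"
proof -
  have "submatrix_mult \<xi> (col_submatrix A \<xi>) v = (\<Sum>j\<in>\<xi>. v j *\<^sub>R column j A)"
    unfolding submatrix_mult_def col_submatrix_def by (rule sum.cong) auto
  also have "\<dots> = (\<Sum>j\<in>UNIV. v (s j) *\<^sub>R column (s j) A)"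
    by (rule sum.reindex_bij_betw[OF assms, symmetric])
  also have "\<dots> = (\<chi> i j. A $ i $ s j) *v (\<chi> j. v (s j))"
    by (simp add: vec_eq_iff matrix_vector_mult_def column_def mult.commute)
  finally show ?thesis .
qed

lemma submatrix_transpose_mult_enum:
  fixes A :: "real^'n^'m" and s :: "'s::finite \<Rightarrow> 'n"
  assumes "bij_betw s UNIV \<xi>"
  shows "submatrix_transpose_mult \<xi> (col_submatrix A \<xi>) y (s j)
    = (transpose (\<chi> i j. A $ i $ s j) *v y) $ j"
proof -
  have "s j \<in> \<xi>" using assms by (auto simp: bij_betw_def)
  then show ?thesis
    by (simp add: submatrix_transpose_mult_def col_submatrix_def matrix_vector_mult_def
        transpose_def column_def inner_vec_def)
qed

definition gradient :: "('a::real_inner \<Rightarrow> real) \<Rightarrow> 'a \<Rightarrow> 'a"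
  where "gradient g x = (THE D. GDERIV g x :> D)"

lemma gradient_eqI:
  assumes "GDERIV g x :> D"
  shows "gradient g x = D"
  unfolding gradient_def
proof (rule the_equality)
  fix E assume "GDERIV g x :> E"
  then have "(\<lambda>h. h \<bullet> E) = (\<lambda>h. h \<bullet> D)"
    using assms unfolding gderiv_def by (rule has_derivative_unique)
  then show "E = D"
    by (metis vector_eq_ldot)
qed (rule assms)

definition strict_descent_direction :: "('a::real_inner \<Rightarrow> real) \<Rightarrow> 'a \<Rightarrow> 'a \<Rightarrow> bool"
  where "strict_descent_direction g x d \<longleftrightarrow> d \<bullet> gradient g x < 0"

text \<open>
  The full derivative \<open>at x\<close>, rather than \<open>at x within D\<close>, makes the Jacobian at every point
  of \<open>D\<close> unique. For open \<open>D\<close> this is the usual notion; otherwise it says that \<open>f\<close> is defined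
  around each point of \<open>D\<close> and differentiable there.
\<close>

definition continuously_differentiable_on :: "(real^'n \<Rightarrow> real^'m) \<Rightarrow> (real^'n) set \<Rightarrow> bool"
  where "continuously_differentiable_on f D \<longleftrightarrow>
    (\<forall>x\<in>D. f differentiable (at x)) \<and> continuous_on D (\<lambda>x. jacobian f (at x))"

end

theory Submission
  imports Defs
begin

text \<open>
  Write \<open>J\<close> for the Jacobian and \<open>r\<close> for the restriction of \<open>\<nabla>g = J\<^sup>T f\<close> to the selected
  coordinates. Then \<open>p\<close> is \<open>r\<close> padded by zeros, so that \<open>J p\<close> is the combination of the selected
  columns with coefficients \<open>r\<close>, and moving these columns across the inner product gives
  \<open>p \<bullet> \<nabla>g = (J p) \<bullet> f = \<parallel>r\<parallel>\<^sup>2 > 0\<close> (\<open>inner_submatrix_mult_transpose_mult\<close>).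
  This single identity is used twice. It shows \<open>J p \<noteq> 0\<close>, hence the step length is a quotient of
  positive numbers times \<open>\<delta>\<close>, that is \<open>\<eta> > 0\<close>; and it evaluates the slope along \<open>d = - \<eta> p\<close> as
  \<open>d \<bullet> \<nabla>g = - \<eta> \<parallel>r\<parallel>\<^sup>2 < 0\<close>. What remains is the formula for \<open>\<nabla>g\<close>, which is the
  chain rule (\<open>gderiv_half_norm_squared\<close>).
\<close>

text \<open>The columns of the identity are the unit vectors, which \<open>A\<close> maps to its own columns.\<close>

lemma matrix_vector_mult_identity_columns:
  fixes A :: "real^'n^'m"
  shows "A *v submatrix_mult \<xi> (col_submatrix (mat 1) \<xi>) v = submatrix_mult \<xi> (col_submatrix A \<xi>) v"
proof -
  have "A *v column j (mat 1) = column j A" for j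
    by (metis matrix_vector_mul_lid matrix_vector_mult_basis)
  then show ?thesis
    by (simp add: submatrix_mult_def col_submatrix_def
        linear_sum[OF matrix_vector_mul_linear] linear_cmul[OF matrix_vector_mul_linear])
qed

text \<open>
  By adjointness, pairing \<open>B (B\<^sup>T y)\<close> with \<open>y\<close> is pairing \<open>B\<^sup>T y\<close> with itself: this is why a step
  built from the partial gradient alone still sees a nonzero slope of the whole objective.
\<close>

lemma inner_submatrix_mult_transpose_mult:
  fixes B :: "'n::finite \<Rightarrow> real^'m"
  shows "submatrix_mult \<xi> B (submatrix_transpose_mult \<xi> B y) \<bullet> y
    = (L2_set (submatrix_transpose_mult \<xi> B y) \<xi>)\<^sup>2"
  by (simp add: submatrix_mult_def submatrix_transpose_mult_def L2_set_def inner_sum_left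
      power2_eq_square sum_nonneg)

lemma inner_transpose_matrix_vector_mult:
  fixes A :: "real^'n^'m"
  shows "h \<bullet> (transpose A *v y) = (A *v h) \<bullet> y"
  by (metis dot_lmul_matrix inner_commute transpose_matrix_vector)

lemma gderiv_half_norm_squared:
  fixes f :: "real^'n \<Rightarrow> real^'m"
  assumes "f differentiable (at x)"
  shows "GDERIV (\<lambda>x. 1 / 2 * (norm (f x))\<^sup>2) x :> transpose (jacobian f (at x)) *v f x"
proof -
  let ?J = "jacobian f (at x)"
  have f': "(f has_derivative (\<lambda>h. ?J *v h)) (at x)"
    using assms jacobian_works by blast
  have "((\<lambda>x. 1 / 2 * (f x \<bullet> f x)) has_derivative
      (\<lambda>h. 1 / 2 * (f x \<bullet> (?J *v h) + (?J *v h) \<bullet> f x))) (at x)"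
    by (intro has_derivative_mult_right has_derivative_inner f')
  also have "(\<lambda>h. 1 / 2 * (f x \<bullet> (?J *v h) + (?J *v h) \<bullet> f x)) = (\<lambda>h. h \<bullet> (transpose ?J *v f x))"
    unfolding inner_transpose_matrix_vector_mult by (simp add: fun_eq_iff inner_commute)
  finally show ?thesis
    by (simp add: gderiv_def power2_norm_eq_inner)
qed

theorem lemma2p1:
  fixes f :: "real^'n \<Rightarrow> real^'m"
    and D :: "(real^'n) set"
    and g :: "real^'n \<Rightarrow> real"
    and x\<^sub>k p\<^sub>k d\<^sub>k :: "real^'n"
    and \<xi>\<^sub>k :: "'n set"
    and \<delta> \<eta>\<^sub>k :: real
    and J :: "real^'n^'m"
    and r :: "'n \<Rightarrow> real"
  assumes f: "continuously_differentiable_on f D"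
    and g: "g = (\<lambda>x. 1 / 2 * (norm (f x))\<^sup>2)"
    and x: "x\<^sub>k \<in> D"
    and \<delta>: "0 < \<delta>" "\<delta> < 2"
    and J: "J = jacobian f (at x\<^sub>k)"
    and r: "r = submatrix_transpose_mult \<xi>\<^sub>k (col_submatrix J \<xi>\<^sub>k) (f x\<^sub>k)"
    and p: "p\<^sub>k = submatrix_mult \<xi>\<^sub>k (col_submatrix (mat 1) \<xi>\<^sub>k) r"
    and \<eta>: "\<eta>\<^sub>k = \<delta> * (((J *v p\<^sub>k) \<bullet> f x\<^sub>k) / ((J *v p\<^sub>k) \<bullet> (J *v p\<^sub>k)))"
    and d: "d\<^sub>k = - \<eta>\<^sub>k *\<^sub>R submatrix_mult \<xi>\<^sub>k (col_submatrix (mat 1) \<xi>\<^sub>k) r"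
    and nonzero: "(L2_set r \<xi>\<^sub>k)\<^sup>2 \<noteq> 0"
  shows "strict_descent_direction g x\<^sub>k d\<^sub>k"
proof -
  define P where "P = (L2_set r \<xi>\<^sub>k)\<^sup>2"
  have P: "P > 0"
    using nonzero by (simp add: P_def)
  have Jp: "(J *v p\<^sub>k) \<bullet> f x\<^sub>k = P"
    by (simp add: P_def p r matrix_vector_mult_identity_columns inner_submatrix_mult_transpose_mult)
  have "J *v p\<^sub>k \<noteq> 0"
    using P Jp by auto
  then have "\<eta>\<^sub>k > 0"
    using \<delta>(1) P by (simp add: \<eta> Jp)
  have "gradient g x\<^sub>k = transpose J *v f x\<^sub>k"
    unfolding g J using f x
    by (intro gradient_eqI gderiv_half_norm_squared) (simp add: continuously_differentiable_on_def)
  then have "p\<^sub>k \<bullet> gradient g x\<^sub>k = P"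
    using Jp by (simp only: inner_transpose_matrix_vector_mult)
  then have "d\<^sub>k \<bullet> gradient g x\<^sub>k = - (\<eta>\<^sub>k * P)"
    by (simp add: d flip: p)
  then show ?thesis
    using P \<open>\<eta>\<^sub>k > 0\<close> by (simp add: strict_descent_direction_def)
qed

end
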